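(* Let $\mathcal{F}$ be the $k$-vector space with basis $a,b,c,d$ equipped with the coassociative coproduct $$\Delta a=a\otimes a+b\otimes c,\quad \Delta b=a\otimes b+b\otimes d,\quad \Delta c=d\otimes c+c\otimes a,\quad \Delta d=d\otimes d+c\otimes b,$$ and let $\tilde\Delta:\mathcal{F}\to\mathcal{F}^{\otimes 2}$ be the linear map $$\tilde\Delta a=b\otimes a+a\otimes c,\quad \tilde\Delta b=b\otimes b+a\otimes d,\quad \tilde\Delta c=c\otimes c+d\otimes a,\quad \tilde\Delta d=c\otimes d+d\otimes b.$$ Then $\tilde\Delta$ is coassociative and verifies the entanglement equation $(\tilde\Delta\otimes id)\Delta=(id\otimes\Delta)\tilde\Delta$. Moreover the two coproducts also verify $(\Delta\otimes id)\tilde\Delta=(id\otimes\tilde\Delta)\Delta$.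
   Context: The field $k$ is $\mathbb{R}$ or $\mathbb{C}$. *)

theory Defs
  imports "HOL-Analysis.Analysis"
begin

text \<open>
  The free vector space with finite basis \<open>'i\<close> over the field \<open>'k\<close> is \<open>'k ^ 'i\<close>, with basis
  vectors \<open>axis i 1\<close> and scalar multiplication \<open>(*s)\<close>. The tensor product of the free spaces on
  \<open>'i\<close> and \<open>'j\<close> is the free space on \<open>'i \<times> 'j\<close>; the lemmas \<open>bilinear_tensor\<close> and
  \<open>tensor_universal\<close> show that it has the universal property of the tensor product over \<open>'k\<close>.
\<close>

definition tensor :: "'k::field ^ 'i::finite \<Rightarrow> 'k ^ 'j::finite \<Rightarrow> 'k ^ ('i \<times> 'j)"  (infixr "\<otimes>" 75) where
  "u \<otimes> v = (\<chi> p. u $ fst p * v $ snd p)"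

definition tensor_map ::
    "('k::field ^ 'i::finite \<Rightarrow> 'k ^ 'm::finite) \<Rightarrow> ('k ^ 'j::finite \<Rightarrow> 'k ^ 'n::finite)
      \<Rightarrow> 'k ^ ('i \<times> 'j) \<Rightarrow> 'k ^ ('m \<times> 'n)"  (infixr "\<otimes>\<^sub>L" 75) where
  "f \<otimes>\<^sub>L g = (\<lambda>x. \<Sum>p\<in>UNIV. x $ p *s (f (axis (fst p) 1) \<otimes> g (axis (snd p) 1)))"

text \<open>The canonical isomorphism \<open>(U \<otimes> V) \<otimes> W \<cong> U \<otimes> (V \<otimes> W)\<close>, which is implicit on paper.\<close>

definition tensor_assoc :: "'k::field ^ (('i::finite \<times> 'j::finite) \<times> 'l::finite) \<Rightarrow> 'k ^ ('i \<times> ('j \<times> 'l))" where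
  "tensor_assoc x = (\<chi> p. x $ ((fst p, fst (snd p)), snd (snd p)))"

definition coassociative :: "('k::field ^ 'i::finite \<Rightarrow> 'k ^ ('i \<times> 'i)) \<Rightarrow> bool" where
  "coassociative D \<longleftrightarrow> tensor_assoc \<circ> (D \<otimes>\<^sub>L id) \<circ> D = (id \<otimes>\<^sub>L D) \<circ> D"

lemma bilinear_tensor:
  "(u + u') \<otimes> v = u \<otimes> v + u' \<otimes> v"  "u \<otimes> (v + v') = u \<otimes> v + u \<otimes> v'"
  "(r *s u) \<otimes> v = r *s (u \<otimes> v)"  "u \<otimes> (r *s v) = r *s (u \<otimes> v)"
  by (simp_all add: tensor_def vec_eq_iff algebra_simps)

lemma axis_tensor_axis: "axis i 1 \<otimes> axis j 1 = axis (i, j) 1"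
  by (auto simp: tensor_def axis_def vec_eq_iff)

lemma vec_linear_iff:
  "Vector_Spaces.linear (*s) (*s) f \<longleftrightarrow>
    (\<forall>x y. f (x + y) = f x + f y) \<and> (\<forall>r x. f (r *s x) = r *s f x)"
  for f :: "'k::field ^ 'i::finite \<Rightarrow> 'k ^ 'j::finite"
  by (simp add: Vector_Spaces.linear_iff vec.vector_space_axioms)

lemma linear_sum_scale:
  assumes "Vector_Spaces.linear s1 s2 f"
  shows "f (\<Sum>i\<in>A. s1 (r i) (x i)) = (\<Sum>i\<in>A. s2 (r i) (f (x i)))"
proof -
  interpret f: Vector_Spaces.linear s1 s2 f by fact
  show ?thesis by (simp only: f.sum f.scale)
qed

lemma linear_basis_expansion:
  fixes scale :: "'k::field \<Rightarrow> 'x::ab_group_add \<Rightarrow> 'x"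
    and f :: "'k ^ 'i::finite \<Rightarrow> 'x"
  assumes "Vector_Spaces.linear (*s) scale f"
  shows "f u = (\<Sum>i\<in>UNIV. scale (u $ i) (f (axis i 1)))"
  using linear_sum_scale[OF assms, of "($) u" "\<lambda>i. axis i 1" UNIV]
  by (simp only: basis_expansion)

lemma sum_UNIV_prod:
  "(\<Sum>p\<in>UNIV. F p) = (\<Sum>i\<in>UNIV. \<Sum>j\<in>UNIV. F (i :: 'i::finite, j :: 'j::finite))"
  by (simp add: sum.cartesian_product)

lemma tensor_universal:
  fixes scale :: "'k::field \<Rightarrow> 'x::ab_group_add \<Rightarrow> 'x"
    and h :: "'k ^ 'i::finite \<Rightarrow> 'k ^ 'j::finite \<Rightarrow> 'x"
  assumes l: "\<And>v. Vector_Spaces.linear (*s) scale (\<lambda>u. h u v)"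
    and r: "\<And>u. Vector_Spaces.linear (*s) scale (h u)"
  shows "\<exists>!H. Vector_Spaces.linear (*s) scale H \<and> (\<forall>u v. H (u \<otimes> v) = h u v)"
proof (rule ex_ex1I)
  have vs: "vector_space scale"
    using r by (simp add: Vector_Spaces.linear_def)
  then interpret X: vector_space scale .
  define H where
    "H x = (\<Sum>p\<in>UNIV. scale (x $ p) (h (axis (fst p) 1) (axis (snd p) 1)))"
    for x :: "'k ^ ('i \<times> 'j)"
  have "Vector_Spaces.linear (*s) scale H"
    unfolding Vector_Spaces.linear_iff
    by (simp add: H_def vec.vector_space_axioms vs X.scale_left_distrib sum.distrib
        X.scale_sum_right)
  moreover have "H (u \<otimes> v) = h u v" for u v
  proof -
    have "h u v = (\<Sum>i\<in>UNIV. scale (u $ i) (h (axis i 1) v))"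
      by (rule linear_basis_expansion[OF l])
    also have "\<dots> = (\<Sum>i\<in>UNIV. scale (u $ i) (\<Sum>j\<in>UNIV. scale (v $ j) (h (axis i 1) (axis j 1))))"
      by (intro sum.cong refl arg_cong[where f = "scale _"] linear_basis_expansion[OF r])
    also have "\<dots> = H (u \<otimes> v)"
      by (simp add: H_def tensor_def sum_UNIV_prod X.scale_sum_right)
    finally show ?thesis by simp
  qed
  ultimately show "\<exists>H. Vector_Spaces.linear (*s) scale H \<and> (\<forall>u v. H (u \<otimes> v) = h u v)"
    by blast
next
  fix H1 H2 :: "'k ^ ('i \<times> 'j) \<Rightarrow> 'x"
  assume H1: "Vector_Spaces.linear (*s) scale H1 \<and> (\<forall>u v. H1 (u \<otimes> v) = h u v)"
    and H2: "Vector_Spaces.linear (*s) scale H2 \<and> (\<forall>u v. H2 (u \<otimes> v) = h u v)"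
  have "H1 (axis (i, j) 1) = H2 (axis (i, j) 1)" for i j
    unfolding axis_tensor_axis[symmetric] using H1 H2 by simp
  then have "H1 (axis p 1) = H2 (axis p 1)" for p
    by (cases p) simp
  then have "H1 x = H2 x" for x
    by (simp only: linear_basis_expansion[OF conjunct1[OF H1], of x]
        linear_basis_expansion[OF conjunct1[OF H2], of x])
  then show "H1 = H2" ..
qed

lemma linear_tensor_map: "Vector_Spaces.linear (*s) (*s) (f \<otimes>\<^sub>L g)"
  unfolding vec_linear_iff
  by (simp_all add: tensor_map_def vec.scale_left_distrib sum.distrib vec.scale_sum_right)

lemma tensor_map_tensor:
  assumes f: "Vector_Spaces.linear (*s) (*s) f" and g: "Vector_Spaces.linear (*s) (*s) g"
  shows "(f \<otimes>\<^sub>L g) (u \<otimes> v) = f u \<otimes> g v"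
  unfolding linear_basis_expansion[OF f, of u] linear_basis_expansion[OF g, of v] tensor_map_def
  by (simp add: vec_eq_iff tensor_def sum_UNIV_prod sum_product mult_ac)

lemma tensor_assoc_tensor: "tensor_assoc ((u \<otimes> v) \<otimes> w) = u \<otimes> (v \<otimes> w)"
  by (simp add: tensor_assoc_def tensor_def vec_eq_iff mult.assoc)

lemma linear_tensor_assoc: "Vector_Spaces.linear (*s) (*s) tensor_assoc"
  unfolding vec_linear_iff
  by (simp_all add: tensor_assoc_def vec_eq_iff)

lemma bij_tensor_assoc: "bij tensor_assoc"
  by (rule o_bij[of "\<lambda>y. \<chi> p. y $ (fst (fst p), (snd (fst p), snd p))"])
    (auto simp: tensor_assoc_def fun_eq_iff vec_eq_iff)

datatype gen = gen_a | gen_b | gen_c | gen_d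

lemma UNIV_gen: "UNIV = {gen_a, gen_b, gen_c, gen_d}"
  using gen.exhaust by auto

instance gen :: finite
  by standard (simp add: UNIV_gen)

abbreviation a :: "'k::field ^ gen" where "a \<equiv> axis gen_a 1"
abbreviation b :: "'k::field ^ gen" where "b \<equiv> axis gen_b 1"
abbreviation c :: "'k::field ^ gen" where "c \<equiv> axis gen_c 1"
abbreviation d :: "'k::field ^ gen" where "d \<equiv> axis gen_d 1"

text \<open>Linear extensions of the values prescribed on the basis.\<close>

definition \<Delta> :: "'k::field ^ gen \<Rightarrow> 'k ^ (gen \<times> gen)" where
  "\<Delta> x =
      x $ gen_a *s (a \<otimes> a + b \<otimes> c)
    + x $ gen_b *s (a \<otimes> b + b \<otimes> d)
    + x $ gen_c *s (d \<otimes> c + c \<otimes> a)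
    + x $ gen_d *s (d \<otimes> d + c \<otimes> b)"

definition \<Delta>t :: "'k::field ^ gen \<Rightarrow> 'k ^ (gen \<times> gen)" where
  "\<Delta>t x =
      x $ gen_a *s (b \<otimes> a + a \<otimes> c)
    + x $ gen_b *s (b \<otimes> b + a \<otimes> d)
    + x $ gen_c *s (c \<otimes> c + d \<otimes> a)
    + x $ gen_d *s (c \<otimes> d + d \<otimes> b)"

lemma linear_\<Delta>: "Vector_Spaces.linear (*s) (*s) \<Delta>"
  unfolding vec_linear_iff
  by (simp_all add: \<Delta>_def vec_eq_iff algebra_simps)

lemma linear_\<Delta>t: "Vector_Spaces.linear (*s) (*s) \<Delta>t"
  unfolding vec_linear_iff
  by (simp_all add: \<Delta>t_def vec_eq_iff algebra_simps)

lemma \<Delta>_basis: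
  "\<Delta> a = a \<otimes> a + b \<otimes> c"  "\<Delta> b = a \<otimes> b + b \<otimes> d"
  "\<Delta> c = d \<otimes> c + c \<otimes> a"  "\<Delta> d = d \<otimes> d + c \<otimes> b"
  by (simp_all add: \<Delta>_def axis_def)

lemma \<Delta>t_basis:
  "\<Delta>t a = b \<otimes> a + a \<otimes> c"  "\<Delta>t b = b \<otimes> b + a \<otimes> d"
  "\<Delta>t c = c \<otimes> c + d \<otimes> a"  "\<Delta>t d = c \<otimes> d + d \<otimes> b"
  by (simp_all add: \<Delta>t_def axis_def)

end

theory Submission
  imports Defs
begin

text \<open>
  Arranged as a \<open>2 \<times> 2\<close> array with rows \<open>a, b\<close> and \<open>c, d\<close>, the basis of the space becomes a system
  of matrix units \<open>e i j\<close>, and \<open>\<Delta>\<close> is the coproduct of the matrix coalgebra,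
  \<open>\<Delta> (e i j) = (\<Sum>k. e i k \<otimes> e k j)\<close>. The second coproduct differs from it only by a twist of the
  summed index: \<open>\<Delta>t (e i j) = (\<Sum>k. e i (s k) \<otimes> e k j)\<close>, where \<open>s\<close> interchanges the two indices.

  For coproducts \<open>D\<close> and \<open>D'\<close> of this form with twists \<open>s\<close> and \<open>t\<close>, both
  \<open>(D \<otimes> id) \<circ> D'\<close> and \<open>(id \<otimes> D') \<circ> D\<close> send \<open>e i j\<close> to
  \<open>\<Sum>k l. e i (s k) \<otimes> e k (t l) \<otimes> e l j\<close>: the outer indices \<open>i\<close> and \<open>j\<close> are untouched, so the order
  of the two insertions does not matter. This is \<open>twisted_coproducts_entangled\<close>, and the two
  coassociativity laws and the two mixed equations are its instances with \<open>s\<close> and \<open>t\<close> ranging over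
  the identity and the interchange.
\<close>

lemma tensor_sum_left: "(\<Sum>k\<in>A. u k) \<otimes> v = (\<Sum>k\<in>A. u k \<otimes> v)"
  by (simp add: tensor_def vec_eq_iff sum_distrib_right)

lemma tensor_sum_right: "u \<otimes> (\<Sum>k\<in>A. v k) = (\<Sum>k\<in>A. u \<otimes> v k)"
  by (simp add: tensor_def vec_eq_iff sum_distrib_left)

lemma image_sum:
  fixes f :: "'k::field ^ 'i::finite \<Rightarrow> 'k ^ 'j::finite"
  assumes "Vector_Spaces.linear (*s) (*s) f"
  shows "f (\<Sum>k\<in>A. x k) = (\<Sum>k\<in>A. f (x k))"
  using linear_sum_scale[OF assms, of "\<lambda>_. 1" x A] by simp

lemma linear_eq_on_basis:
  fixes f g :: "'k::field ^ 'i::finite \<Rightarrow> 'k ^ 'j::finite"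
  assumes f: "Vector_Spaces.linear (*s) (*s) f" and g: "Vector_Spaces.linear (*s) (*s) g"
    and eq: "\<And>i. f (axis i 1) = g (axis i 1)"
  shows "f = g"
proof
  fix x
  show "f x = g x"
    unfolding linear_basis_expansion[OF f, of x] linear_basis_expansion[OF g, of x] by (simp only: eq)
qed

text \<open>
  A twist acts only on the column of the left factor of each summand. Splitting that left factor once
  more passes its column on to the middle factor, and splitting the right factor passes its row on to
  the middle factor. Either way \<open>s\<close> ends up in the first column and \<open>t\<close> in the second, and the two
  results differ by an exchange of the sums.
\<close>

lemma twisted_coproducts_entangled:
  fixes D D' :: "'k::field ^ 'i::finite \<Rightarrow> 'k ^ ('i \<times> 'i)"
    and e :: "'n::finite \<Rightarrow> 'n \<Rightarrow> 'k ^ 'i"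
  assumes lin: "Vector_Spaces.linear (*s) (*s) D" and lin': "Vector_Spaces.linear (*s) (*s) D'"
    and basis: "\<And>g. \<exists>i j. axis g 1 = e i j"
    and D: "\<And>i j. D (e i j) = (\<Sum>k\<in>UNIV. e i (s k) \<otimes> e k j)"
    and D': "\<And>i j. D' (e i j) = (\<Sum>k\<in>UNIV. e i (t k) \<otimes> e k j)"
  shows "tensor_assoc \<circ> (D \<otimes>\<^sub>L id) \<circ> D' = (id \<otimes>\<^sub>L D') \<circ> D"
proof (rule linear_eq_on_basis)
  show "Vector_Spaces.linear (*s) (*s) (tensor_assoc \<circ> (D \<otimes>\<^sub>L id) \<circ> D')"
    using Vector_Spaces.linear_compose[OF lin'
        Vector_Spaces.linear_compose[OF linear_tensor_map linear_tensor_assoc]]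
    by (simp only: comp_assoc)
  show "Vector_Spaces.linear (*s) (*s) ((id \<otimes>\<^sub>L D') \<circ> D)"
    by (rule Vector_Spaces.linear_compose[OF lin linear_tensor_map])
  fix g
  obtain i j where g: "axis g 1 = e i j"
    using basis by blast
  have "(tensor_assoc \<circ> (D \<otimes>\<^sub>L id) \<circ> D') (e i j)
      = (\<Sum>l\<in>UNIV. \<Sum>k\<in>UNIV. e i (s k) \<otimes> e k (t l) \<otimes> e l j)"
    by (simp add: D D' image_sum[OF linear_tensor_map] image_sum[OF linear_tensor_assoc]
        tensor_map_tensor[OF lin vec.linear_id]
        tensor_sum_left tensor_assoc_tensor)
  also have "\<dots> = (\<Sum>k\<in>UNIV. \<Sum>l\<in>UNIV. e i (s k) \<otimes> e k (t l) \<otimes> e l j)"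
    by (rule sum.swap)
  also have "\<dots> = ((id \<otimes>\<^sub>L D') \<circ> D) (e i j)"
    by (simp add: D D' image_sum[OF linear_tensor_map]
        tensor_map_tensor[OF vec.linear_id lin'] tensor_sum_right)
  finally show "(tensor_assoc \<circ> (D \<otimes>\<^sub>L id) \<circ> D') (axis g 1) = ((id \<otimes>\<^sub>L D') \<circ> D) (axis g 1)"
    unfolding g .
qed

text \<open>
  Rows and columns are indexed by \<open>bool\<close>, with \<open>False\<close> as the first index, so that the interchange
  of the two indices is negation.
\<close>

fun matrix_unit :: "bool \<Rightarrow> bool \<Rightarrow> 'k::field ^ gen" where
  "matrix_unit False False = a"
| "matrix_unit False True = b"
| "matrix_unit True False = c"
| "matrix_unit True True = d"

lemma axis_eq_matrix_unit: "\<exists>i j. axis g 1 = (matrix_unit i j :: 'k::field ^ gen)"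
  by (cases g) (metis matrix_unit.simps)+

lemma \<Delta>_matrix_unit:
  "\<Delta> (matrix_unit i j) = (\<Sum>k\<in>UNIV. matrix_unit i (id k) \<otimes> matrix_unit k j)"
  by (cases i; cases j) (simp_all add: \<Delta>_basis UNIV_bool add.commute)

lemma \<Delta>t_matrix_unit:
  "\<Delta>t (matrix_unit i j) = (\<Sum>k\<in>UNIV. matrix_unit i (\<not> k) \<otimes> matrix_unit k j)"
  by (cases i; cases j) (simp_all add: \<Delta>t_basis UNIV_bool add.commute)

lemma coassociative_\<Delta>: "coassociative \<Delta>"
  unfolding coassociative_def
  by (rule twisted_coproducts_entangled[OF linear_\<Delta> linear_\<Delta> axis_eq_matrix_unit
        \<Delta>_matrix_unit \<Delta>_matrix_unit])

lemma coassociative_\<Delta>t: "coassociative \<Delta>t"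
  unfolding coassociative_def
  by (rule twisted_coproducts_entangled[OF linear_\<Delta>t linear_\<Delta>t axis_eq_matrix_unit
        \<Delta>t_matrix_unit \<Delta>t_matrix_unit])

lemma entanglement_\<Delta>t_\<Delta>: "tensor_assoc \<circ> (\<Delta>t \<otimes>\<^sub>L id) \<circ> \<Delta> = (id \<otimes>\<^sub>L \<Delta>) \<circ> \<Delta>t"
  by (rule twisted_coproducts_entangled[OF linear_\<Delta>t linear_\<Delta> axis_eq_matrix_unit
        \<Delta>t_matrix_unit \<Delta>_matrix_unit])

lemma entanglement_\<Delta>_\<Delta>t: "tensor_assoc \<circ> (\<Delta> \<otimes>\<^sub>L id) \<circ> \<Delta>t = (id \<otimes>\<^sub>L \<Delta>t) \<circ> \<Delta>"
  by (rule twisted_coproducts_entangled[OF linear_\<Delta> linear_\<Delta>t axis_eq_matrix_unit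
        \<Delta>_matrix_unit \<Delta>t_matrix_unit])

theorem theorem3p1:
  shows
    "(coassociative (\<Delta> :: real ^ gen \<Rightarrow> real ^ (gen \<times> gen)) \<and>
      coassociative (\<Delta>t :: real ^ gen \<Rightarrow> real ^ (gen \<times> gen)) \<and>
      tensor_assoc \<circ> (\<Delta>t \<otimes>\<^sub>L id) \<circ> \<Delta>
        = (id \<otimes>\<^sub>L \<Delta>) \<circ> (\<Delta>t :: real ^ gen \<Rightarrow> real ^ (gen \<times> gen)) \<and>
      tensor_assoc \<circ> (\<Delta> \<otimes>\<^sub>L id) \<circ> \<Delta>t
        = (id \<otimes>\<^sub>L \<Delta>t) \<circ> (\<Delta> :: real ^ gen \<Rightarrow> real ^ (gen \<times> gen))) \<and>
     (coassociative (\<Delta> :: complex ^ gen \<Rightarrow> complex ^ (gen \<times> gen)) \<and>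
      coassociative (\<Delta>t :: complex ^ gen \<Rightarrow> complex ^ (gen \<times> gen)) \<and>
      tensor_assoc \<circ> (\<Delta>t \<otimes>\<^sub>L id) \<circ> \<Delta>
        = (id \<otimes>\<^sub>L \<Delta>) \<circ> (\<Delta>t :: complex ^ gen \<Rightarrow> complex ^ (gen \<times> gen)) \<and>
      tensor_assoc \<circ> (\<Delta> \<otimes>\<^sub>L id) \<circ> \<Delta>t
        = (id \<otimes>\<^sub>L \<Delta>t) \<circ> (\<Delta> :: complex ^ gen \<Rightarrow> complex ^ (gen \<times> gen)))"
  by (intro conjI coassociative_\<Delta> coassociative_\<Delta>t entanglement_\<Delta>t_\<Delta> entanglement_\<Delta>_\<Delta>t)

end
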